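(* Let $G$ be a connected graph. If $A_\infty(x)=2I_{\deg(x)}$ for every $x\in V(G)$, then $G$ is a regular locally cubical graph.
   Context: Graphs are simple, unweighted and locally finite. $S_k(x)$ denotes the set of vertices at distance exactly $k$ from $x$. Curvature matrix: write $S_1(x)=\{y_1,\dots,y_{\deg(x)}\}$. For $i\ne j$ let $\varepsilon_{ij}=1$ if $y_i\sim y_j$ and $0$ otherwise, and $\omega_{ij}=\sum_{z\in S_2(x),\,z\sim y_i,\,z\sim y_j}\frac{1}{d_x^-(z)}$, where $d_x^-(z)=|S_1(x)\cap S_1(z)|$. Let $t_i=\sum_{j\ne i}\varepsilon_{ij}$ and $\Omega_i=\sum_{j\neq i}\omega_{ij}$. The curvature matrix $A_\infty(x)$ is the symmetric $\deg(x)\times\deg(x)$ matrix with $(A_\infty(x))_{ij}=1-2\varepsilon_{ij}-2\omega_{ij}$ for $i\neq j$ and $(A_\infty(x))_{ii}=3-\frac{\deg(x)+\deg(y_i)}{2}+\frac52t_i+2\Omega_i$. Exact square incidence: for $x\in V(G)$ and distinct $y,z\in S_1(x)$, the triple $(x;y,z)$ satisfies exact square incidence if (a) $y\not\sim z$; (b) there is a unique $w\in S_2(x)$ with $w\sim y$ and $w\sim z$; (c) this $w$ satisfies $S_1(x)\cap S_1(w)=\{y,z\}$. $G$ is locally cubical if for every $x\in V(G)$ and any two distinct $y,z\in S_1(x)$ the triple $(x;y,z)$ satisfies exact square incidence. *)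

theory Defs
  imports "Graph_Theory.Graph_Theory" "Jordan_Normal_Form.Matrix"
begin

text \<open>
  Simple graphs are symmetric digraphs without loops and parallel arcs. The vertex set may be
  infinite. An undirected edge is a pair of opposite arcs, so the degree of a vertex is its
  \<^const>\<open>out_degree\<close> and adjacency is \<^const>\<open>dominates\<close>.
\<close>

locale locally_finite_graph = loopfree_digraph + nomulti_digraph + sym_digraph +
  assumes finite_out_arcs: "x \<in> verts G \<Longrightarrow> finite (out_arcs G x)"

text \<open>With unit weights, the shortest-path cost is the combinatorial distance (infinite if there is no walk).\<close>

definition sphere :: "('a, 'b) pre_digraph \<Rightarrow> nat \<Rightarrow> 'a \<Rightarrow> 'a set" where
  "sphere G k x = {v \<in> verts G. wf_digraph.\<mu> G (\<lambda>_. 1) x v = ereal (real k)}"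

definition back_degree :: "('a, 'b) pre_digraph \<Rightarrow> 'a \<Rightarrow> 'a \<Rightarrow> nat" where
  "back_degree G x z = card (sphere G 1 x \<inter> sphere G 1 z)"

definition adj_entry :: "('a, 'b) pre_digraph \<Rightarrow> 'a \<Rightarrow> 'a \<Rightarrow> real" where
  "adj_entry G y y' = (if y \<rightarrow>\<^bsub>G\<^esub> y' then 1 else 0)"

definition square_weight :: "('a, 'b) pre_digraph \<Rightarrow> 'a \<Rightarrow> 'a \<Rightarrow> 'a \<Rightarrow> real" where
  "square_weight G x y y' =
     (\<Sum>z \<in> {z \<in> sphere G 2 x. z \<rightarrow>\<^bsub>G\<^esub> y \<and> z \<rightarrow>\<^bsub>G\<^esub> y'}. 1 / real (back_degree G x z))"

text \<open>
  The list \<open>ys\<close> is an enumeration of the neighbours of \<open>x\<close>, indexed from 0. The matrix depends on it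
  only up to a simultaneous permutation of rows and columns.
\<close>

definition nbr_enum :: "('a, 'b) pre_digraph \<Rightarrow> 'a \<Rightarrow> 'a list \<Rightarrow> bool" where
  "nbr_enum G x ys \<longleftrightarrow> distinct ys \<and> set ys = sphere G 1 x"

definition curvature_matrix :: "('a, 'b) pre_digraph \<Rightarrow> 'a \<Rightarrow> 'a list \<Rightarrow> real mat" where
  "curvature_matrix G x ys =
     (let n = out_degree G x;
          \<epsilon> = (\<lambda>i j. adj_entry G (ys ! i) (ys ! j));
          \<omega> = (\<lambda>i j. square_weight G x (ys ! i) (ys ! j));
          t = (\<lambda>i. \<Sum>j \<in> {..<n} - {i}. \<epsilon> i j);
          \<Omega> = (\<lambda>i. \<Sum>j \<in> {..<n} - {i}. \<omega> i j)
      in mat n n (\<lambda>(i, j).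
           if i = j
           then 3 - (real n + real (out_degree G (ys ! i))) / 2 + 5 / 2 * t i + 2 * \<Omega> i
           else 1 - 2 * \<epsilon> i j - 2 * \<omega> i j))"

definition exact_square_incidence :: "('a, 'b) pre_digraph \<Rightarrow> 'a \<Rightarrow> 'a \<Rightarrow> 'a \<Rightarrow> bool" where
  "exact_square_incidence G x y z \<longleftrightarrow>
     \<not> y \<rightarrow>\<^bsub>G\<^esub> z \<and>
     (\<exists>!w. w \<in> sphere G 2 x \<and> w \<rightarrow>\<^bsub>G\<^esub> y \<and> w \<rightarrow>\<^bsub>G\<^esub> z) \<and>
     (\<forall>w. w \<in> sphere G 2 x \<and> w \<rightarrow>\<^bsub>G\<^esub> y \<and> w \<rightarrow>\<^bsub>G\<^esub> z \<longrightarrow> sphere G 1 x \<inter> sphere G 1 w = {y, z})"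

definition locally_cubical :: "('a, 'b) pre_digraph \<Rightarrow> bool" where
  "locally_cubical G \<longleftrightarrow>
     (\<forall>x \<in> verts G. \<forall>y \<in> sphere G 1 x. \<forall>z \<in> sphere G 1 x.
        y \<noteq> z \<longrightarrow> exact_square_incidence G x y z)"

definition regular_graph :: "('a, 'b) pre_digraph \<Rightarrow> bool" where
  "regular_graph G \<longleftrightarrow> (\<exists>d. \<forall>x \<in> verts G. out_degree G x = d)"

end

theory Submission
  imports Defs
begin

text \<open>
  Write \<open>N(x)\<close> for the neighbours of \<open>x\<close>. The condition that the curvature matrix at \<open>x\<close> equals
  \<open>2 I\<close> splits into an off-diagonal and a diagonal part. Off the diagonal it says that
  \<open>\<epsilon> + \<omega> = 1/2\<close> for every pair of neighbours; since \<open>\<omega> \<ge> 0\<close> and \<open>\<epsilon> \<in> {0, 1}\<close>, there are no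
  triangles and every \<open>\<omega>\<close> is \<open>1/2\<close>. With these values the diagonal entry collapses to
  \<open>2 + (deg x - deg y) / 2\<close>, so adjacent vertices have equal degree, and connectedness gives
  regularity.

  What remains is to exclude that a weight \<open>\<omega> = 1/2\<close> is made up of several vertices of large back
  degree. This uses the hypothesis at two different base points. First, if \<open>w\<close> has distance 2
  from \<open>x\<close>, via a midpoint \<open>y\<close>, then \<open>x\<close> and \<open>w\<close> are two neighbours of \<open>y\<close> with positive weight
  at \<open>y\<close>, so \<open>x\<close> and \<open>w\<close> have a second common neighbour: all back degrees are at least 2
  (lemma \<open>back_degree_ge_2\<close>). Secondly, fix \<open>y \<in> N(x)\<close> and sum the weights \<open>\<omega>\<close> over the
  other \<open>n - 1\<close> neighbours of \<open>x\<close>, where \<open>n = deg x\<close>. Double counting gives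
  \<open>\<Sum>w \<in> N(y) - {x}. (1 - 1 / d(w)) = (n - 1) / 2\<close>, where \<open>d(w)\<close> is the back degree. As
  \<open>deg y = n\<close>, the sum has exactly \<open>n - 1\<close> terms, each at least \<open>1/2\<close>; hence each is \<open>1/2\<close> and
  \<open>d(w) = 2\<close> (lemma \<open>back_degree_eq_2\<close>). Now a weight \<open>1/2\<close> is a sum of terms \<open>1/2\<close>, so it comes
  from a single vertex, whose two back neighbours are the given pair.
\<close>

section \<open>Spheres of radius one and two\<close>

text \<open>The infimum defining the distance is attained, because with unit costs it is an infimum of
  natural numbers.\<close>

lemma (in wf_digraph) mem_sphere_iff:
  "v \<in> sphere G k x \<longleftrightarrow> (\<exists>p. awalk x p v \<and> length p = k) \<and> (\<forall>p. awalk x p v \<longrightarrow> k \<le> length p)"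
    (is "_ \<longleftrightarrow> ?R")
proof -
  have cost: "awalk_cost (\<lambda>_. 1) p = real (length p)" for p
    by (induction p) auto
  have mu: "\<mu> (\<lambda>_. 1) x v = ereal (real m)"
    if "awalk x p v" "length p = m" "\<And>q. awalk x q v \<Longrightarrow> m \<le> length q" for p m
    unfolding \<mu>_def cost using that by (intro INF_eqI) auto
  show ?thesis
  proof
    assume v: "v \<in> sphere G k x"
    then have k: "\<mu> (\<lambda>_. 1) x v = ereal (real k)" by (simp add: sphere_def)
    have "x \<rightarrow>\<^sup>* v" using k shortest_path_inf[of x v "\<lambda>_. 1"] by auto
    then obtain p0 where "awalk x p0 v" by (auto simp: reachable_awalk)
    from ex_has_least_nat[of "\<lambda>p. awalk x p v", OF this, of length]
    obtain p where p: "awalk x p v" "\<And>q. awalk x q v \<Longrightarrow> length p \<le> length q" by blast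
    from mu[OF p(1) refl p(2)] k have "length p = k" by simp
    with p show ?R by auto
  next
    assume ?R
    then obtain p where p: "awalk x p v" "length p = k" "\<And>q. awalk x q v \<Longrightarrow> k \<le> length q" by blast
    from mu[OF p] p(1) show "v \<in> sphere G k x" by (auto simp: sphere_def)
  qed
qed

context locally_finite_graph
begin

lemma adj_sym: "u \<rightarrow>\<^bsub>G\<^esub> v \<Longrightarrow> v \<rightarrow>\<^bsub>G\<^esub> u"
  using sym_arcs unfolding symmetric_def by (rule symD)

lemma awalk_length_1_iff: "(\<exists>p. awalk x p v \<and> length p = Suc 0) \<longleftrightarrow> x \<rightarrow>\<^bsub>G\<^esub> v"
proof
  assume "\<exists>p. awalk x p v \<and> length p = Suc 0"
  then obtain e where "awalk x [e] v" by (auto simp: length_Suc_conv)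
  then show "x \<rightarrow>\<^bsub>G\<^esub> v" using in_arcs_imp_in_arcs_ends[of e] by (simp add: awalk_simps)
next
  assume "x \<rightarrow>\<^bsub>G\<^esub> v"
  then obtain e where "e \<in> arcs G" "tail G e = x" "head G e = v"
    unfolding arcs_ends_conv by auto
  then have "awalk x [e] v" by (auto simp: awalk_simps)
  then show "\<exists>p. awalk x p v \<and> length p = Suc 0" by (intro exI[of _ "[e]"]) simp
qed

lemma awalk_length_2_iff:
  "(\<exists>p. awalk x p v \<and> length p = Suc (Suc 0)) \<longleftrightarrow> (\<exists>y. x \<rightarrow>\<^bsub>G\<^esub> y \<and> y \<rightarrow>\<^bsub>G\<^esub> v)"
proof
  assume "\<exists>p. awalk x p v \<and> length p = Suc (Suc 0)"
  then obtain e f where "awalk x [e, f] v" by (auto simp: length_Suc_conv)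
  then show "\<exists>y. x \<rightarrow>\<^bsub>G\<^esub> y \<and> y \<rightarrow>\<^bsub>G\<^esub> v"
    using in_arcs_imp_in_arcs_ends[of e] in_arcs_imp_in_arcs_ends[of f]
    by (intro exI[of _ "head G e"]) (simp add: awalk_simps)
next
  assume "\<exists>y. x \<rightarrow>\<^bsub>G\<^esub> y \<and> y \<rightarrow>\<^bsub>G\<^esub> v"
  then obtain e f where "e \<in> arcs G" "f \<in> arcs G" "tail G e = x" "head G e = tail G f" "head G f = v"
    unfolding arcs_ends_conv by auto
  then have "awalk x [e, f] v" by (auto simp: awalk_simps)
  then show "\<exists>p. awalk x p v \<and> length p = Suc (Suc 0)"
    by (intro exI[of _ "[e, f]"]) simp
qed

lemma awalk_length_0_iff: "(\<exists>p. awalk x p v \<and> length p = 0) \<longleftrightarrow> x = v \<and> x \<in> verts G"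
  by (auto simp: awalk_simps)

lemma sphere_1: "sphere G 1 x = {v. x \<rightarrow>\<^bsub>G\<^esub> v}"
proof (rule Set.set_eqI)
  fix v
  have "(\<forall>p. awalk x p v \<longrightarrow> 1 \<le> length p) \<longleftrightarrow> \<not> (\<exists>p. awalk x p v \<and> length p = 0)"
    by (auto simp: Suc_le_eq)
  then show "v \<in> sphere G 1 x \<longleftrightarrow> v \<in> {v. x \<rightarrow>\<^bsub>G\<^esub> v}"
    unfolding mem_sphere_iff awalk_length_0_iff
    using awalk_length_1_iff adj_not_same by auto
qed

lemma mem_sphere_2_iff:
  "v \<in> sphere G 2 x \<longleftrightarrow> v \<noteq> x \<and> \<not> x \<rightarrow>\<^bsub>G\<^esub> v \<and> (\<exists>y. x \<rightarrow>\<^bsub>G\<^esub> y \<and> y \<rightarrow>\<^bsub>G\<^esub> v)"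
proof -
  have "2 \<le> n \<longleftrightarrow> n \<noteq> 0 \<and> n \<noteq> Suc 0" for n :: nat by auto
  then have "(\<forall>p. awalk x p v \<longrightarrow> 2 \<le> length p) \<longleftrightarrow>
      \<not> (\<exists>p. awalk x p v \<and> length p = 0) \<and> \<not> (\<exists>p. awalk x p v \<and> length p = Suc 0)"
    by blast
  then show ?thesis
    unfolding mem_sphere_iff awalk_length_0_iff awalk_length_1_iff
    using awalk_length_2_iff[of x v] adj_in_verts(1)[of x] by (auto simp: numeral_2_eq_2)
qed

lemma nbrs_eq_image: "{v. x \<rightarrow>\<^bsub>G\<^esub> v} = head G ` out_arcs G x"
  unfolding arcs_ends_conv out_arcs_def by auto

lemma out_degree_eq_card_nbrs: "out_degree G x = card {v. x \<rightarrow>\<^bsub>G\<^esub> v}"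
proof -
  have "inj_on (head G) (out_arcs G x)"
    by (intro inj_onI no_multi_arcs) (auto simp: arc_to_ends_def)
  then show ?thesis by (simp add: out_degree_def nbrs_eq_image card_image)
qed

lemma finite_nbrs: "finite {v. x \<rightarrow>\<^bsub>G\<^esub> v}"
proof (cases "x \<in> verts G")
  case True
  with finite_out_arcs show ?thesis by (simp add: nbrs_eq_image)
next
  case False
  then have "{v. x \<rightarrow>\<^bsub>G\<^esub> v} = {}" using adj_in_verts by blast
  then show ?thesis by simp
qed

lemma back_degree_eq: "back_degree G x w = card {y. x \<rightarrow>\<^bsub>G\<^esub> y \<and> w \<rightarrow>\<^bsub>G\<^esub> y}"
  unfolding back_degree_def sphere_1 Collect_conj_eq ..

section \<open>Reading off the curvature matrix\<close>

lemma square_weight_nonneg: "0 \<le> square_weight G x y z"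
  unfolding square_weight_def by (intro sum_nonneg) simp

text \<open>The entries of the matrix, indexed by neighbours of \<open>x\<close> instead of list positions.\<close>

lemma curvature_matrix_eq_2I_D:
  assumes enum: "nbr_enum G x ys"
    and curv: "curvature_matrix G x ys = 2 \<cdot>\<^sub>m 1\<^sub>m (out_degree G x)"
    and y: "x \<rightarrow>\<^bsub>G\<^esub> y"
  shows "\<And>z. x \<rightarrow>\<^bsub>G\<^esub> z \<Longrightarrow> y \<noteq> z \<Longrightarrow> 1 - 2 * adj_entry G y z - 2 * square_weight G x y z = 0"
    and "3 - (real (out_degree G x) + real (out_degree G y)) / 2
          + 5 / 2 * (\<Sum>z \<in> {v. x \<rightarrow>\<^bsub>G\<^esub> v} - {y}. adj_entry G y z)
          + 2 * (\<Sum>z \<in> {v. x \<rightarrow>\<^bsub>G\<^esub> v} - {y}. square_weight G x y z) = 2"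
proof -
  let ?n = "out_degree G x"
  have ys: "distinct ys" "set ys = {v. x \<rightarrow>\<^bsub>G\<^esub> v}"
    using enum sphere_1 by (auto simp: nbr_enum_def)
  have len: "length ys = ?n"
    using ys distinct_card[of ys] by (simp add: out_degree_eq_card_nbrs)
  obtain i where i: "i < ?n" "ys ! i = y"
    using y ys(2) len by (metis in_set_conv_nth mem_Collect_eq)
  have entry: "curvature_matrix G x ys $$ (i, j) = (if i = j then 2 else 0)" if "j < ?n" for j
    unfolding curv using that i by simp
  {
    fix z assume "x \<rightarrow>\<^bsub>G\<^esub> z" "y \<noteq> z"
    then obtain j where j: "j < ?n" "ys ! j = z"
      using ys(2) len by (metis in_set_conv_nth mem_Collect_eq)
    have "i \<noteq> j" using i j \<open>y \<noteq> z\<close> by auto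
    then show "1 - 2 * adj_entry G y z - 2 * square_weight G x y z = 0"
      using entry[of j] i j by (simp add: curvature_matrix_def Let_def)
  }
  have "bij_betw ((!) ys) {..<?n} (set ys)"
    using ys(1) len by (intro bij_betw_nth) auto
  then have "bij_betw ((!) ys) ({..<?n} - {i}) (set ys - {y})"
    using i by (auto simp: bij_betw_def inj_on_def)
  from sum.reindex_bij_betw[OF this]
  have sum: "(\<Sum>j \<in> {..<?n} - {i}. f (ys ! j)) = (\<Sum>z \<in> {v. x \<rightarrow>\<^bsub>G\<^esub> v} - {y}. f z)" for f :: "'a \<Rightarrow> real"
    by (simp add: ys(2))
  show "3 - (real (out_degree G x) + real (out_degree G y)) / 2
          + 5 / 2 * (\<Sum>z \<in> {v. x \<rightarrow>\<^bsub>G\<^esub> v} - {y}. adj_entry G y z)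
          + 2 * (\<Sum>z \<in> {v. x \<rightarrow>\<^bsub>G\<^esub> v} - {y}. square_weight G x y z) = 2"
    using entry[of i] i sum[of "adj_entry G y"] sum[of "square_weight G x y"]
    by (simp add: curvature_matrix_def Let_def)
qed

text \<open>Off the diagonal an edge \<open>yz\<close> would force weight \<open>- 1 / 2\<close>, which is negative. The diagonal
  entry then involves only the two degrees.\<close>

lemma curvature_matrix_eq_2I_imp:
  assumes "nbr_enum G x ys"
    and "curvature_matrix G x ys = 2 \<cdot>\<^sub>m 1\<^sub>m (out_degree G x)"
    and y: "x \<rightarrow>\<^bsub>G\<^esub> y"
  shows "\<And>z. x \<rightarrow>\<^bsub>G\<^esub> z \<Longrightarrow> y \<noteq> z \<Longrightarrow> \<not> y \<rightarrow>\<^bsub>G\<^esub> z \<and> square_weight G x y z = 1 / 2"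
    and "out_degree G y = out_degree G x"
proof -
  show off: "\<not> y \<rightarrow>\<^bsub>G\<^esub> z \<and> square_weight G x y z = 1 / 2" if "x \<rightarrow>\<^bsub>G\<^esub> z" "y \<noteq> z" for z
    using curvature_matrix_eq_2I_D(1)[OF assms that] square_weight_nonneg[of x y z]
    by (auto simp: adj_entry_def split: if_splits)
  have "(\<Sum>z \<in> {v. x \<rightarrow>\<^bsub>G\<^esub> v} - {y}. adj_entry G y z) = 0"
    using off by (intro sum.neutral) (auto simp: adj_entry_def)
  moreover have "(\<Sum>z \<in> {v. x \<rightarrow>\<^bsub>G\<^esub> v} - {y}. square_weight G x y z)
      = (\<Sum>z \<in> {v. x \<rightarrow>\<^bsub>G\<^esub> v} - {y}. 1 / 2)"
    using off by (intro sum.cong) auto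
  moreover have "real (card ({v. x \<rightarrow>\<^bsub>G\<^esub> v} - {y})) = real (out_degree G x) - 1"
    using y card_Suc_Diff1[OF finite_nbrs, of y x] by (simp add: out_degree_eq_card_nbrs)
  ultimately show "out_degree G y = out_degree G x"
    using curvature_matrix_eq_2I_D(2)[OF assms] by (simp add: field_simps)
qed

text \<open>In a symmetric digraph connectedness gives directed reachability, along which local
  constancy of the degree propagates.\<close>

lemma regular_if_degree_locally_constant:
  assumes conn: "Digraph_Component.connected G"
    and deg: "\<And>x y. x \<rightarrow>\<^bsub>G\<^esub> y \<Longrightarrow> out_degree G y = out_degree G x"
  shows "regular_graph G"
proof -
  have reach: "u \<rightarrow>\<^sup>* v" if "u \<in> verts G" "v \<in> verts G" for u v
    using conn that reachable_mk_symmetric_eq[OF sym_arcs]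
    by (auto simp: Digraph_Component.connected_def strongly_connected_def)
  have "out_degree G v = out_degree G u" if "u \<rightarrow>\<^sup>* v" for u v
    using that by (induction rule: reachable_induct) (auto simp: deg)
  with reach show ?thesis unfolding regular_graph_def by metis
qed

end

section \<open>Rigidity of the square weights\<close>

text \<open>These conditions are imposed at every vertex, so that the argument can move from \<open>x\<close> to one of
  its neighbours as base point.\<close>

locale half_weight_graph = locally_finite_graph +
  assumes no_triangle: "x \<rightarrow>\<^bsub>G\<^esub> y \<Longrightarrow> x \<rightarrow>\<^bsub>G\<^esub> z \<Longrightarrow> y \<noteq> z \<Longrightarrow> \<not> y \<rightarrow>\<^bsub>G\<^esub> z"
    and half_weight: "x \<rightarrow>\<^bsub>G\<^esub> y \<Longrightarrow> x \<rightarrow>\<^bsub>G\<^esub> z \<Longrightarrow> y \<noteq> z \<Longrightarrow> square_weight G x y z = 1 / 2"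
    and degree_eq: "x \<rightarrow>\<^bsub>G\<^esub> y \<Longrightarrow> out_degree G y = out_degree G x"
begin

text \<open>Without triangles, a neighbour of \<open>y\<close> other than \<open>x\<close> cannot be adjacent to \<open>x\<close>; hence exactly
  \<open>deg y - 1\<close> vertices at distance 2 from \<open>x\<close> are adjacent to \<open>y\<close>.\<close>

lemma nbr_in_sphere_2_iff:
  assumes "x \<rightarrow>\<^bsub>G\<^esub> y"
  shows "w \<in> sphere G 2 x \<and> w \<rightarrow>\<^bsub>G\<^esub> y \<longleftrightarrow> y \<rightarrow>\<^bsub>G\<^esub> w \<and> w \<noteq> x"
  using assms no_triangle[of y x w] adj_sym unfolding mem_sphere_2_iff by blast

text \<open>Change of base point: \<open>x\<close> and \<open>w\<close> are neighbours of any midpoint \<open>y\<close>, and their positive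
  weight at \<open>y\<close> needs a common neighbour that lies at distance 2 from \<open>y\<close>.\<close>

lemma back_degree_ge_2:
  assumes "w \<in> sphere G 2 x"
  shows "2 \<le> back_degree G x w"
proof -
  from assms obtain y where y: "x \<rightarrow>\<^bsub>G\<^esub> y" "y \<rightarrow>\<^bsub>G\<^esub> w" and "w \<noteq> x"
    by (auto simp: mem_sphere_2_iff)
  have "square_weight G y x w = 1 / 2"
    using half_weight[OF adj_sym[OF y(1)] y(2)] \<open>w \<noteq> x\<close> by simp
  then have "{v \<in> sphere G 2 y. v \<rightarrow>\<^bsub>G\<^esub> x \<and> v \<rightarrow>\<^bsub>G\<^esub> w} \<noteq> {}"
    by (auto simp: square_weight_def simp del: Collect_empty_eq)
  then obtain v where v: "v \<in> sphere G 2 y" "v \<rightarrow>\<^bsub>G\<^esub> x" "v \<rightarrow>\<^bsub>G\<^esub> w" by blast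
  then have "{y, v} \<subseteq> {u. x \<rightarrow>\<^bsub>G\<^esub> u \<and> w \<rightarrow>\<^bsub>G\<^esub> u}" using y adj_sym by blast
  moreover have "y \<noteq> v" using v by (auto simp: mem_sphere_2_iff)
  moreover have "finite {u. x \<rightarrow>\<^bsub>G\<^esub> u \<and> w \<rightarrow>\<^bsub>G\<^esub> u}"
    using finite_nbrs[of x] by (rule rev_finite_subset) auto
  ultimately show ?thesis
    unfolding back_degree_eq using card_mono[of "{u. x \<rightarrow>\<^bsub>G\<^esub> u \<and> w \<rightarrow>\<^bsub>G\<^esub> u}" "{y, v}"] by simp
qed

text \<open>Both sums range over the edges between \<open>N(x) - {y}\<close> and \<open>N(y) - {x}\<close>, each edge weighted by
  the inverse back degree of its second endpoint \<open>w\<close>. The edges at \<open>w\<close> contribute \<open>d(w) - 1\<close> terms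
  \<open>1 / d(w)\<close>, because \<open>y\<close> is one of the \<open>d(w)\<close> back neighbours of \<open>w\<close> and is left out.\<close>

lemma sum_square_weights:
  assumes xy: "x \<rightarrow>\<^bsub>G\<^esub> y"
  shows "(\<Sum>z \<in> {v. x \<rightarrow>\<^bsub>G\<^esub> v} - {y}. square_weight G x y z)
       = (\<Sum>w \<in> {v. y \<rightarrow>\<^bsub>G\<^esub> v} - {x}. 1 - 1 / real (back_degree G x w))"
proof -
  let ?N = "{v. x \<rightarrow>\<^bsub>G\<^esub> v} - {y}" and ?M = "{v. y \<rightarrow>\<^bsub>G\<^esub> v} - {x}"
  let ?d = "\<lambda>w. real (back_degree G x w)"
  have "{w \<in> sphere G 2 x. w \<rightarrow>\<^bsub>G\<^esub> y \<and> w \<rightarrow>\<^bsub>G\<^esub> z} = {w \<in> ?M. w \<rightarrow>\<^bsub>G\<^esub> z}" for z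
    using nbr_in_sphere_2_iff[OF xy] by blast
  then have "(\<Sum>z \<in> ?N. square_weight G x y z) = (\<Sum>z \<in> ?N. \<Sum>w \<in> {w \<in> ?M. w \<rightarrow>\<^bsub>G\<^esub> z}. 1 / ?d w)"
    by (simp add: square_weight_def)
  also have "\<dots> = (\<Sum>w \<in> ?M. \<Sum>z \<in> {z \<in> ?N. w \<rightarrow>\<^bsub>G\<^esub> z}. 1 / ?d w)"
    by (intro sum.swap_restrict) (simp_all add: finite_nbrs)
  also have "\<dots> = (\<Sum>w \<in> ?M. 1 - 1 / ?d w)"
  proof (intro sum.cong refl)
    fix w assume w: "w \<in> ?M"
    let ?B = "{u. x \<rightarrow>\<^bsub>G\<^esub> u \<and> w \<rightarrow>\<^bsub>G\<^esub> u}"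
    have w2: "w \<in> sphere G 2 x" using w nbr_in_sphere_2_iff[OF xy] by blast
    have "finite ?B" using finite_nbrs[of x] by (rule rev_finite_subset) auto
    moreover have "y \<in> ?B" using xy w adj_sym by auto
    ultimately have "Suc (card (?B - {y})) = back_degree G x w"
      unfolding back_degree_eq by (rule card_Suc_Diff1)
    moreover have "{z \<in> ?N. w \<rightarrow>\<^bsub>G\<^esub> z} = ?B - {y}" by auto
    ultimately have "real (card {z \<in> ?N. w \<rightarrow>\<^bsub>G\<^esub> z}) = ?d w - 1" by simp
    then show "(\<Sum>z \<in> {z \<in> ?N. w \<rightarrow>\<^bsub>G\<^esub> z}. 1 / ?d w) = 1 - 1 / ?d w"
      using back_degree_ge_2[OF w2] by (simp add: diff_divide_distrib)
  qed
  finally show ?thesis .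
qed

text \<open>The sum above equals \<open>(deg x - 1) / 2\<close>, and each of its \<open>deg y - 1 = deg x - 1\<close> terms is at
  least \<open>1/2\<close>; so there is equality throughout.\<close>

lemma back_degree_eq_2:
  assumes "w \<in> sphere G 2 x"
  shows "back_degree G x w = 2"
proof -
  from assms obtain y where y: "x \<rightarrow>\<^bsub>G\<^esub> y" "y \<rightarrow>\<^bsub>G\<^esub> w" and "w \<noteq> x"
    by (auto simp: mem_sphere_2_iff)
  let ?N = "{v. x \<rightarrow>\<^bsub>G\<^esub> v} - {y}" and ?M = "{v. y \<rightarrow>\<^bsub>G\<^esub> v} - {x}"
  let ?d = "\<lambda>w. real (back_degree G x w)"
  have "Suc (card ?N) = out_degree G x" "Suc (card ?M) = out_degree G y"
    unfolding out_degree_eq_card_nbrs using y(1) adj_sym[OF y(1)]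
    by (simp_all only: card_Suc_Diff1 finite_nbrs mem_Collect_eq)
  then have card: "card ?N = card ?M" using degree_eq[OF y(1)] by simp
  have "(\<Sum>z \<in> ?N. square_weight G x y z) = (\<Sum>z \<in> ?N. 1 / 2)"
    using half_weight[OF y(1)] by (intro sum.cong) auto
  then have "(\<Sum>v \<in> ?M. (1 - 1 / ?d v) - 1 / 2) = 0"
    using card sum_square_weights[OF y(1)] by (simp add: sum_subtractf)
  moreover have "0 \<le> (1 - 1 / ?d v) - 1 / 2" if "v \<in> ?M" for v
  proof -
    have "v \<in> sphere G 2 x" using that nbr_in_sphere_2_iff[OF y(1)] by blast
    from back_degree_ge_2[OF this] show ?thesis by (simp add: field_simps)
  qed
  ultimately have "(1 - 1 / ?d v) - 1 / 2 = 0" if "v \<in> ?M" for v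
    using that sum_nonneg_eq_0_iff[of ?M "\<lambda>v. (1 - 1 / ?d v) - 1 / 2"] finite_nbrs by simp
  from this[of w] y \<open>w \<noteq> x\<close> have "1 / ?d w = 1 / 2" by simp
  then show ?thesis by (simp add: field_simps)
qed

lemma locally_cubical: "locally_cubical G"
proof -
  have "exact_square_incidence G x y z"
    if xy: "x \<rightarrow>\<^bsub>G\<^esub> y" and xz: "x \<rightarrow>\<^bsub>G\<^esub> z" and ne: "y \<noteq> z" for x y z
  proof -
    let ?C = "{w \<in> sphere G 2 x. w \<rightarrow>\<^bsub>G\<^esub> y \<and> w \<rightarrow>\<^bsub>G\<^esub> z}"
    have "square_weight G x y z = (\<Sum>w \<in> ?C. 1 / 2)"
      unfolding square_weight_def using back_degree_eq_2 by (intro sum.cong) auto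
    then have "card ?C = 1" using half_weight[OF that] by simp
    then obtain w0 where w0: "?C = {w0}" by (auto simp: card_1_singleton_iff)
    have "\<exists>!w. w \<in> ?C" unfolding w0 by simp
    moreover have "sphere G 1 x \<inter> sphere G 1 w = {y, z}" if w: "w \<in> ?C" for w
    proof (rule sym, rule card_subset_eq)
      show "finite (sphere G 1 x \<inter> sphere G 1 w)" unfolding sphere_1 by (intro finite_Int disjI1 finite_nbrs)
      show "{y, z} \<subseteq> sphere G 1 x \<inter> sphere G 1 w" unfolding sphere_1 using w xy xz by auto
      show "card {y, z} = card (sphere G 1 x \<inter> sphere G 1 w)"
        using w ne back_degree_eq_2[of w x] by (simp add: back_degree_def)
    qed
    ultimately show ?thesis
      unfolding exact_square_incidence_def using no_triangle[OF that] by simp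
  qed
  then show ?thesis unfolding locally_cubical_def sphere_1 by simp
qed

end

theorem theorem6p14:
  fixes G :: "('a, 'b) pre_digraph" and nb :: "'a \<Rightarrow> 'a list"
  assumes "locally_finite_graph G"
    and "Digraph_Component.connected G"
    and "\<And>x. x \<in> verts G \<Longrightarrow> nbr_enum G x (nb x)"
    and "\<And>x. x \<in> verts G \<Longrightarrow> curvature_matrix G x (nb x) = 2 \<cdot>\<^sub>m 1\<^sub>m (out_degree G x)"
  shows "regular_graph G \<and> locally_cubical G"
proof -
  interpret locally_finite_graph G by fact
  note imp = curvature_matrix_eq_2I_imp[OF assms(3) assms(4)]
  have deg: "out_degree G y = out_degree G x" if "x \<rightarrow>\<^bsub>G\<^esub> y" for x y
    using imp(2) adj_in_verts(1) that by blast
  interpret half_weight_graph G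
  proof
    fix x y z assume "x \<rightarrow>\<^bsub>G\<^esub> y" "x \<rightarrow>\<^bsub>G\<^esub> z" "y \<noteq> z"
    then have "\<not> y \<rightarrow>\<^bsub>G\<^esub> z \<and> square_weight G x y z = 1 / 2"
      using imp(1) adj_in_verts(1) by blast
    then show "\<not> y \<rightarrow>\<^bsub>G\<^esub> z" "square_weight G x y z = 1 / 2" by simp_all
  qed (rule deg)
  show ?thesis
    using regular_if_degree_locally_constant[OF assms(2) deg] locally_cubical by simp
qed

end
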